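(* Let $p,q\in\mathbb{C}^*$ with $p\neq q$. The Hom-Lie algebra $$\left(W_{p,q},\quad [d_n,d_m]_{p,q} = \left( \frac{[n]_{p,q}}{p^n} - \frac{[m]_{p,q}}{p^m} \right) d_{n+m},\quad \alpha_{p,q}(d_n) = (1+(q/p)^n) d_n \right)$$ is isomorphic, as a Hom-Lie algebra, to the Hom-Lie algebra $$\left(W_{q/p},\quad [d_n,d_m]_{q/p} = \left( \{n\}_{q/p} - \{m\}_{q/p} \right) d_{n+m},\quad \alpha_{q/p}(d_n) = (1+(q/p)^n) d_n \right).$$
   Context: $W_{p,q}$ and $W_{q/p}$ are complex vector spaces, each with a basis denoted $\{d_n\}_{n\in\mathbb{Z}}$. For $n\in\mathbb{Z}$: $[n]_{p,q} = \dfrac{p^n-q^n}{p-q}$, and $\{n\}_r = \dfrac{1-r^n}{1-r}$ for $r\neq 1$. A Hom-Lie algebra over $\mathbb{C}$ is a triple $(L,[\cdot,\cdot],\alpha)$ with $L$ a vector space, $[\cdot,\cdot]$ a bilinear skew-symmetric bracket on $L$ and $\alpha:L\to L$ a linear map such that $[\alpha(x),[y,z]]+[\alpha(y),[z,x]]+[\alpha(z),[x,y]]=0$ for all $x,y,z$. A morphism of Hom-Lie algebras $(L,[\cdot,\cdot],\alpha)\to(L',[\cdot,\cdot]',\alpha')$ is a linear map $\varphi$ with $[\varphi(x),\varphi(y)]'=\varphi([x,y])$ for all $x,y$ and $\varphi\circ\alpha=\alpha'\circ\varphi$; an isomorphism is a bijective morphism. *)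

theory Defs
  imports Complex_Main
begin

definition pq_number :: "complex \<Rightarrow> complex \<Rightarrow> int \<Rightarrow> complex" where
  "pq_number p q n = (p powi n - q powi n) / (p - q)"

definition q_number :: "complex \<Rightarrow> int \<Rightarrow> complex" where
  "q_number r n = (1 - r powi n) / (1 - r)"

definition indexed_basis :: "(complex \<Rightarrow> 'a \<Rightarrow> 'a::ab_group_add) \<Rightarrow> ('i \<Rightarrow> 'a) \<Rightarrow> bool" where
  "indexed_basis scale d \<longleftrightarrow>
     vector_space scale \<and> inj d \<and>
     \<not> module.dependent scale (range d) \<and> module.span scale (range d) = UNIV"

definition bilinear_bracket ::
  "(complex \<Rightarrow> 'a \<Rightarrow> 'a::ab_group_add) \<Rightarrow> ('a \<Rightarrow> 'a \<Rightarrow> 'a) \<Rightarrow> bool" where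
  "bilinear_bracket scale br \<longleftrightarrow>
     (\<forall>y. Vector_Spaces.linear scale scale (\<lambda>x. br x y)) \<and>
     (\<forall>x. Vector_Spaces.linear scale scale (\<lambda>y. br x y))"

locale hom_lie_algebra =
  vector_space scale
  for scale :: "complex \<Rightarrow> 'a \<Rightarrow> 'a::ab_group_add" +
  fixes br :: "'a \<Rightarrow> 'a \<Rightarrow> 'a" and \<alpha> :: "'a \<Rightarrow> 'a"
  assumes bilinear: "bilinear_bracket scale br"
    and skew_symmetric: "br x y = - br y x"
    and linear_twist: "Vector_Spaces.linear scale scale \<alpha>"
    and hom_Jacobi: "br (\<alpha> x) (br y z) + br (\<alpha> y) (br z x) + br (\<alpha> z) (br x y) = 0"

locale hom_lie_morphism =
  source: hom_lie_algebra scale1 br1 \<alpha>1 +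
  target: hom_lie_algebra scale2 br2 \<alpha>2
  for scale1 :: "complex \<Rightarrow> 'a \<Rightarrow> 'a::ab_group_add" and br1 \<alpha>1
    and scale2 :: "complex \<Rightarrow> 'b \<Rightarrow> 'b::ab_group_add" and br2 \<alpha>2 +
  fixes \<phi> :: "'a \<Rightarrow> 'b"
  assumes linear_map: "Vector_Spaces.linear scale1 scale2 \<phi>"
    and map_bracket: "br2 (\<phi> x) (\<phi> y) = \<phi> (br1 x y)"
    and map_twist: "\<phi> \<circ> \<alpha>1 = \<alpha>2 \<circ> \<phi>"

definition hom_lie_isomorphic ::
  "(complex \<Rightarrow> 'a \<Rightarrow> 'a::ab_group_add) \<Rightarrow> ('a \<Rightarrow> 'a \<Rightarrow> 'a) \<Rightarrow> ('a \<Rightarrow> 'a) \<Rightarrow>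
   (complex \<Rightarrow> 'b \<Rightarrow> 'b::ab_group_add) \<Rightarrow> ('b \<Rightarrow> 'b \<Rightarrow> 'b) \<Rightarrow> ('b \<Rightarrow> 'b) \<Rightarrow> bool" where
  "hom_lie_isomorphic scale1 br1 \<alpha>1 scale2 br2 \<alpha>2 \<longleftrightarrow>
     (\<exists>\<phi>. hom_lie_morphism scale1 br1 \<alpha>1 scale2 br2 \<alpha>2 \<phi> \<and> bij \<phi>)"

text \<open>The two algebras are given on an arbitrary complex vector space with a basis indexed by
  the integers. Bilinearity and linearity together with the values on the basis determine
  bracket and twist uniquely; skew-symmetry and the Hom-Jacobi identity are not part of
  these predicates.\<close>

definition is_W_pq ::
  "complex \<Rightarrow> complex \<Rightarrow> (complex \<Rightarrow> 'a \<Rightarrow> 'a::ab_group_add) \<Rightarrow> (int \<Rightarrow> 'a) \<Rightarrow>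
   ('a \<Rightarrow> 'a \<Rightarrow> 'a) \<Rightarrow> ('a \<Rightarrow> 'a) \<Rightarrow> bool" where
  "is_W_pq p q scale d br \<alpha> \<longleftrightarrow>
     indexed_basis scale d \<and>
     bilinear_bracket scale br \<and>
     Vector_Spaces.linear scale scale \<alpha> \<and>
     (\<forall>n m. br (d n) (d m) =
        scale (pq_number p q n / p powi n - pq_number p q m / p powi m) (d (n + m))) \<and>
     (\<forall>n. \<alpha> (d n) = scale (1 + (q / p) powi n) (d n))"

definition is_W_q ::
  "complex \<Rightarrow> (complex \<Rightarrow> 'a \<Rightarrow> 'a::ab_group_add) \<Rightarrow> (int \<Rightarrow> 'a) \<Rightarrow>
   ('a \<Rightarrow> 'a \<Rightarrow> 'a) \<Rightarrow> ('a \<Rightarrow> 'a) \<Rightarrow> bool" where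
  "is_W_q r scale d br \<alpha> \<longleftrightarrow>
     indexed_basis scale d \<and>
     bilinear_bracket scale br \<and>
     Vector_Spaces.linear scale scale \<alpha> \<and>
     (\<forall>n m. br (d n) (d m) = scale (q_number r n - q_number r m) (d (n + m))) \<and>
     (\<forall>n. \<alpha> (d n) = scale (1 + r powi n) (d n))"

end

theory Submission
  imports Defs
begin

text \<open>Write \<open>r = q / p\<close>. Since \<open>[n] / p\<^sup>n = {n} / p\<close>, the structure constants of the two brackets differ
  by the factor \<open>1 / p\<close>. A bracket is quadratic in the generators while its value is linear in them, so
  the linear map with \<open>d\<^sub>n \<mapsto> d\<^sub>n / p\<close> absorbs this factor; it commutes with the twists, which are diagonal
  with the same eigenvalues. By multilinearity the Hom-Lie axioms reduce to basis vectors, where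
  Hom-Jacobi becomes a polynomial identity in \<open>r\<^sup>k\<close>, \<open>r\<^sup>m\<close>, \<open>r\<^sup>n\<close>.\<close>

lemma linear_eq_on_basis:
  assumes "indexed_basis s1 d" "Vector_Spaces.linear s1 s2 f" "Vector_Spaces.linear s1 s2 g"
    and "\<And>n. f (d n) = g (d n)"
  shows "f x = g x"
proof -
  interpret f: Vector_Spaces.linear s1 s2 f by fact
  interpret vector_space_pair s1 s2 ..
  show ?thesis
    by (rule linear_eq_on[OF assms(2,3), of _ "range d"])
      (use assms(1,4) in \<open>auto simp: indexed_basis_def\<close>)
qed

text \<open>The library extends a function given on the basis vectors themselves. Here values are
  prescribed by index, so \<open>g\<close> is composed with \<open>inv d\<close>; injectivity of
  \<open>d\<close> gives \<open>inv d (d n) = n\<close>.\<close>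

lemma linear_extension_basis:
  assumes "indexed_basis s1 d" "vector_space s2"
  obtains f where "Vector_Spaces.linear s1 s2 f" "\<And>n. f (d n) = g n"
proof -
  interpret v1: vector_space s1 using assms(1) by (simp add: indexed_basis_def)
  interpret v2: vector_space s2 by fact
  interpret vector_space_pair s1 s2 ..
  from assms(1) have "inj d" "v1.independent (range d)" by (auto simp: indexed_basis_def)
  with linear_independent_extend[of "range d" "g \<circ> inv d"] that show ?thesis
    by auto
qed

text \<open>Equational form of bilinearity, used below as a set of rewrite rules.\<close>

lemma bilinear_bracket_iff:
  assumes "vector_space scale"
  shows "bilinear_bracket scale br \<longleftrightarrow>
    (\<forall>x y z. br (x + y) z = br x z + br y z) \<and> (\<forall>c x y. br (scale c x) y = scale c (br x y)) \<and>
    (\<forall>x y z. br x (y + z) = br x y + br x z) \<and> (\<forall>c x y. br x (scale c y) = scale c (br x y))"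
  using assms by (auto simp: bilinear_bracket_def Vector_Spaces.linear_iff)

lemma bilinear_eq_on_basis:
  assumes "indexed_basis s d" "bilinear_bracket s f" "bilinear_bracket s g"
    and "\<And>n m. f (d n) (d m) = g (d n) (d m)"
  shows "f x y = g x y"
proof -
  have "f (d n) y = g (d n) y" for n
    by (rule linear_eq_on_basis[of s d s "f (d n)" "g (d n)"])
      (use assms in \<open>auto simp: bilinear_bracket_def\<close>)
  with assms show ?thesis
    using linear_eq_on_basis[of s d s "\<lambda>x. f x y" "\<lambda>x. g x y" x]
    by (auto simp: bilinear_bracket_def)
qed

text \<open>The free factor \<open>c\<close> lets one argument serve both algebras:
  \<open>c = inverse p\<close> for the two-parameter bracket and \<open>c = 1\<close> for the
  other.\<close>

lemma hom_lie_algebra_q_bracket: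
  assumes basis: "indexed_basis s d" and bil: "bilinear_bracket s br"
    and lin: "Vector_Spaces.linear s s \<alpha>" and "r \<noteq> 0"
    and br_d: "\<And>n m. br (d n) (d m) = s (c * (q_number r n - q_number r m)) (d (n + m))"
    and \<alpha>_d: "\<And>n. \<alpha> (d n) = s (1 + r powi n) (d n)"
  shows "hom_lie_algebra s br \<alpha>"
proof -
  interpret vector_space s using basis by (simp add: indexed_basis_def)
  have vs: "vector_space s" ..
  note bil' = bil[unfolded bilinear_bracket_iff[OF vs]]
  have lin': "\<alpha> (x + y) = \<alpha> x + \<alpha> y" "\<alpha> (s a x) = s a (\<alpha> x)" for x y a
    using lin by (auto simp: Vector_Spaces.linear_iff)
  have skew_d: "br (d n) (d m) = - br (d m) (d n)" for n m
    by (simp add: br_d add.commute[of m n] right_diff_distrib flip: scale_minus_left)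
  have skew: "br x y = - br y x" for x y
    by (rule bilinear_eq_on_basis[OF basis bil, of "\<lambda>x y. - br y x"])
      (auto simp: bilinear_bracket_iff[OF vs] bil' intro: skew_d)
  \<comment> \<open>\<open>J\<close> is the Hom-Jacobiator. Being cyclic, it needs linearity only in
    its first slot to be controlled in all three.\<close>
  define J where "J x y z = br (\<alpha> x) (br y z) + br (\<alpha> y) (br z x) + br (\<alpha> z) (br x y)" for x y z
  have J_cyclic: "J x y z = J y z x" for x y z by (simp add: J_def ac_simps)
  have J_linear: "Vector_Spaces.linear s s (\<lambda>x. J x y z)" for y z
    by (auto simp: Vector_Spaces.linear_iff vs J_def bil' lin' scale_right_distrib ac_simps)
  have J_0: "J x y z = 0" if "\<And>n. J (d n) y z = 0" for x y z
    using linear_eq_on_basis[OF basis J_linear[of y z], of "\<lambda>_. 0" x] that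
    by (simp add: Vector_Spaces.linear_iff vs)
  have J_basis: "J (d k) (d m) (d n) = 0" for k m n
  proof -
    \<comment> \<open>Isolating the common denominator as a factor \<open>h\<close> leaves only
      powers of \<open>r\<close>. The constant 1 drops out of differences of q-numbers, and each of
      the two nested brackets contributes one factor \<open>c * h\<close>.\<close>
    define h where "h = inverse (1 - r)"
    have q: "q_number r i = (1 - r powi i) * h" for i
      by (simp add: q_number_def h_def divide_inverse)
    have summand: "br (\<alpha> (d i)) (br (d j) (d l)) =
        s ((1 + r powi i) * (r powi l - r powi j) * (r powi j * r powi l - r powi i) * (c * h)\<^sup>2)
          (d (i + (j + l)))" for i j l
    proof -
      have "br (\<alpha> (d i)) (br (d j) (d l)) =
          s ((1 + r powi i) * ((c * (q_number r j - q_number r l))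
            * (c * (q_number r i - q_number r (j + l))))) (d (i + (j + l)))"
        by (simp add: br_d \<alpha>_d bil' mult.assoc)
      also have "q_number r j - q_number r l = (r powi l - r powi j) * h"
        by (simp add: q left_diff_distrib)
      also have "q_number r i - q_number r (j + l) = (r powi j * r powi l - r powi i) * h"
        using \<open>r \<noteq> 0\<close> by (simp add: q power_int_add left_diff_distrib)
      finally show ?thesis by (simp add: power2_eq_square mult_ac)
    qed
    \<comment> \<open>Brings the cyclically permuted index sums to one form, so that all three
      summands are multiples of the same basis vector.\<close>
    have index: "m + (n + k) = k + (m + n)" "n + (k + m) = k + (m + n)" by auto
    \<comment> \<open>Here \<open>a\<close>, \<open>b\<close>, \<open>e\<close> stand for the powers
      of \<open>r\<close> with exponents \<open>k\<close>, \<open>m\<close>, \<open>n\<close>, and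
      \<open>w\<close> for the square of \<open>c * h\<close>.\<close>
    have "(1 + a) * (e - b) * (b * e - a) * w + (1 + b) * (a - e) * (e * a - b) * w
        + (1 + e) * (b - a) * (a * b - e) * w = 0" for a b e w :: complex
      by algebra
    then show ?thesis
      unfolding J_def summand index scale_left_distrib[symmetric] by simp
  qed
  have J_zero: "J x y z = 0" for x y z
  proof -
    \<comment> \<open>\<open>J_0\<close> replaces a basis vector by an arbitrary one in the first
      slot only; rotating between its uses frees the three slots one after another.\<close>
    have two: "J (d k) (d m) z = 0" for k m z
      using J_0[OF J_basis, of z k m] unfolding J_cyclic[of z] .
    have "J (d n) y (d k) = 0" for n y k
      using two[of k n y] unfolding J_cyclic[of "d n" y] J_cyclic[of y] .
    from J_0[OF this] have "J (d k) y z = 0" for k y z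
      by (subst J_cyclic)
    then show ?thesis by (rule J_0)
  qed
  show ?thesis
    by (intro hom_lie_algebra.intro hom_lie_algebra_axioms.intro vs bil skew lin J_zero[unfolded J_def])
qed

text \<open>Under \<open>d1 n\<close> \<mapsto> \<open>s2 c (d2 n)\<close> both sides of the bracket
  condition on basis vectors have coefficient \<open>c * c * t n m\<close>: two rescaled generators
  on one side, one structure constant and one rescaled generator on the other.\<close>

lemma hom_lie_isomorphic_rescaled_basis:
  assumes "hom_lie_algebra s1 br1 \<alpha>1" "hom_lie_algebra s2 br2 \<alpha>2"
    and basis1: "indexed_basis s1 d1" and basis2: "indexed_basis s2 d2" and "c \<noteq> 0"
    and br1_d: "\<And>n m. br1 (d1 n) (d1 m) = s1 (c * t n m) (d1 (n + m))"
    and br2_d: "\<And>n m. br2 (d2 n) (d2 m) = s2 (t n m) (d2 (n + m))"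
    and \<alpha>1_d: "\<And>n. \<alpha>1 (d1 n) = s1 (u n) (d1 n)"
    and \<alpha>2_d: "\<And>n. \<alpha>2 (d2 n) = s2 (u n) (d2 n)"
  shows "hom_lie_isomorphic s1 br1 \<alpha>1 s2 br2 \<alpha>2"
proof -
  interpret L1: hom_lie_algebra s1 br1 \<alpha>1 by fact
  interpret L2: hom_lie_algebra s2 br2 \<alpha>2 by fact
  have vs1: "vector_space s1" and vs2: "vector_space s2" ..
  obtain \<phi> where \<phi>: "Vector_Spaces.linear s1 s2 \<phi>" "\<And>n. \<phi> (d1 n) = s2 c (d2 n)"
    using linear_extension_basis[OF basis1 vs2, of "\<lambda>n. s2 c (d2 n)"] by blast
  \<comment> \<open>The inverse rescaling yields bijectivity of \<open>\<phi>\<close>, since both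
    composites fix the basis vectors.\<close>
  obtain \<psi> where \<psi>: "Vector_Spaces.linear s2 s1 \<psi>" "\<And>n. \<psi> (d2 n) = s1 (inverse c) (d1 n)"
    using linear_extension_basis[OF basis2 vs1, of "\<lambda>n. s1 (inverse c) (d1 n)"] by blast
  interpret \<phi>: Vector_Spaces.linear s1 s2 \<phi> by fact
  interpret \<psi>: Vector_Spaces.linear s2 s1 \<psi> by fact
  note bil1 = L1.bilinear[unfolded bilinear_bracket_iff[OF vs1]]
    and bil2 = L2.bilinear[unfolded bilinear_bracket_iff[OF vs2]]
  have "\<psi> (\<phi> x) = x" for x
    by (rule linear_eq_on_basis[OF basis1, of s1 "\<lambda>x. \<psi> (\<phi> x)" "\<lambda>x. x"])
      (use \<open>c \<noteq> 0\<close> in \<open>auto simp: Vector_Spaces.linear_iff vs1 \<phi>.add \<phi>.scale \<psi>.add \<psi>.scale \<phi>(2) \<psi>(2)\<close>)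
  moreover have "\<phi> (\<psi> x) = x" for x
    by (rule linear_eq_on_basis[OF basis2, of s2 "\<lambda>x. \<phi> (\<psi> x)" "\<lambda>x. x"])
      (use \<open>c \<noteq> 0\<close> in \<open>auto simp: Vector_Spaces.linear_iff vs2 \<phi>.add \<phi>.scale \<psi>.add \<psi>.scale \<phi>(2) \<psi>(2)\<close>)
  ultimately have "bij \<phi>" by (intro o_bij[of \<psi>]) (auto simp: fun_eq_iff)
  \<comment> \<open>The maps compared here go from the first space to the second, so
    \<open>bilinear_eq_on_basis\<close> does not apply; the two slots are extended from the basis
    one at a time.\<close>
  have bracket_d: "br2 (\<phi> (d1 n)) (\<phi> y) = \<phi> (br1 (d1 n) y)" for n y
    by (rule linear_eq_on_basis[OF basis1, of s2 "\<lambda>y. br2 (\<phi> (d1 n)) (\<phi> y)"])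
      (auto simp: Vector_Spaces.linear_iff vs1 vs2 \<phi>.add \<phi>.scale bil1 bil2 \<phi>(2) br1_d br2_d mult_ac
        L2.scale_right_distrib)
  have bracket: "br2 (\<phi> x) (\<phi> y) = \<phi> (br1 x y)" for x y
    by (rule linear_eq_on_basis[OF basis1, of s2 "\<lambda>x. br2 (\<phi> x) (\<phi> y)"])
      (auto simp: Vector_Spaces.linear_iff vs1 vs2 \<phi>.add \<phi>.scale bil1 bil2 bracket_d)
  have lin_\<alpha>: "Vector_Spaces.linear s1 s2 (\<phi> \<circ> \<alpha>1)" "Vector_Spaces.linear s1 s2 (\<alpha>2 \<circ> \<phi>)"
    using Vector_Spaces.linear_compose L1.linear_twist L2.linear_twist \<phi>(1) by blast+
  interpret \<alpha>2: Vector_Spaces.linear s2 s2 \<alpha>2 by (rule L2.linear_twist)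
  have "(\<phi> \<circ> \<alpha>1) x = (\<alpha>2 \<circ> \<phi>) x" for x
    by (rule linear_eq_on_basis[OF basis1 lin_\<alpha>])
      (simp add: \<alpha>1_d \<alpha>2_d \<phi>.scale \<alpha>2.scale \<phi>(2) mult_ac)
  then have "\<phi> \<circ> \<alpha>1 = \<alpha>2 \<circ> \<phi>" by blast
  with bracket \<phi>(1) have "hom_lie_morphism s1 br1 \<alpha>1 s2 br2 \<alpha>2 \<phi>" by unfold_locales
  with \<open>bij \<phi>\<close> show ?thesis by (auto simp: hom_lie_isomorphic_def)
qed

text \<open>Dividing by \<open>p powi n\<close> turns the numerator into
  \<open>1 - (q / p) powi n\<close>, and \<open>p - q = p * (1 - q / p)\<close> supplies the factor
  \<open>inverse p\<close>.\<close>

lemma pq_number_eq_q_number: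
  assumes "p \<noteq> 0" "p \<noteq> q"
  shows "pq_number p q n / p powi n = inverse p * q_number (q / p) n"
proof -
  have "q_number (q / p) n = (1 - q powi n / p powi n) / (1 - q / p)"
    by (simp add: q_number_def power_int_divide_distrib)
  also have "1 - q / p = (p - q) / p" using assms by (simp add: field_simps)
  finally show ?thesis using assms by (simp add: pq_number_def divide_simps mult_ac)
qed

theorem proposition3p3:
  fixes p q :: complex
    and scale1 :: "complex \<Rightarrow> 'a \<Rightarrow> 'a::ab_group_add"
    and d1 :: "int \<Rightarrow> 'a" and br1 :: "'a \<Rightarrow> 'a \<Rightarrow> 'a" and \<alpha>1 :: "'a \<Rightarrow> 'a"
    and scale2 :: "complex \<Rightarrow> 'b \<Rightarrow> 'b::ab_group_add"
    and d2 :: "int \<Rightarrow> 'b" and br2 :: "'b \<Rightarrow> 'b \<Rightarrow> 'b" and \<alpha>2 :: "'b \<Rightarrow> 'b"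
  assumes "p \<noteq> 0" and "q \<noteq> 0" and "p \<noteq> q"
    and "is_W_pq p q scale1 d1 br1 \<alpha>1"
    and "is_W_q (q / p) scale2 d2 br2 \<alpha>2"
  shows "hom_lie_algebra scale1 br1 \<alpha>1 \<and>
         hom_lie_algebra scale2 br2 \<alpha>2 \<and>
         hom_lie_isomorphic scale1 br1 \<alpha>1 scale2 br2 \<alpha>2"
proof -
  let ?r = "q / p"
  let ?t = "\<lambda>n m. q_number ?r n - q_number ?r m"
  have "?r \<noteq> 0" using assms by simp
  have W1: "indexed_basis scale1 d1" "bilinear_bracket scale1 br1"
    "Vector_Spaces.linear scale1 scale1 \<alpha>1" "\<And>n. \<alpha>1 (d1 n) = scale1 (1 + ?r powi n) (d1 n)"
    and br1: "\<And>n m. br1 (d1 n) (d1 m) = scale1 (inverse p * ?t n m) (d1 (n + m))"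
    using assms by (auto simp: is_W_pq_def pq_number_eq_q_number right_diff_distrib)
  have W2: "indexed_basis scale2 d2" "bilinear_bracket scale2 br2"
    "Vector_Spaces.linear scale2 scale2 \<alpha>2" "\<And>n. \<alpha>2 (d2 n) = scale2 (1 + ?r powi n) (d2 n)"
    and br2: "\<And>n m. br2 (d2 n) (d2 m) = scale2 (?t n m) (d2 (n + m))"
    using assms by (auto simp: is_W_q_def)
  have L1: "hom_lie_algebra scale1 br1 \<alpha>1"
    by (rule hom_lie_algebra_q_bracket[OF W1(1-3) \<open>?r \<noteq> 0\<close> br1 W1(4)])
  have L2: "hom_lie_algebra scale2 br2 \<alpha>2"
    by (rule hom_lie_algebra_q_bracket[OF W2(1-3) \<open>?r \<noteq> 0\<close>, where c = 1]) (simp_all add: br2 W2(4))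
  have "hom_lie_isomorphic scale1 br1 \<alpha>1 scale2 br2 \<alpha>2"
    by (rule hom_lie_isomorphic_rescaled_basis[OF L1 L2 W1(1) W2(1), where
          c = "inverse p" and t = ?t and u = "\<lambda>n. 1 + ?r powi n"])
      (use \<open>p \<noteq> 0\<close> in \<open>simp_all only: br1 br2 W1(4) W2(4) inverse_nonzero_iff_nonzero not_False_eq_True\<close>)
  with L1 L2 show ?thesis by blast
qed

end
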